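(* Let $K$ be a field, let $P=K[a_0,a_1,\dots,a_n]$, let $g_1,\dots,g_r\in P$, let $S=K[g_1,\dots,g_r]$, and let $g\in S\setminus\{0\}$. Let $A$ be a finitely generated $K$-subalgebra of $P$ such that $S\subseteq A\subseteq S:g^\infty$. Then (for any choices of generators made in the construction of $E_g$): (a) $K[S:g^i]\subseteq E_g^i(S)\subseteq S:g^\infty$ for every $i\ge 0$. (b) $S=E_g^0(S)\subseteq E_g^1(S)\subseteq\cdots\subseteq E_g^i(S)\subseteq S:g^\infty$ for every $i\ge 0$. (c) $A:g^\infty=S:g^\infty$. (d) If $A=E_g(A)$, then $A=S:g^\infty$.
   Context: For a subset $T\subseteq P$, $K[T]$ denotes the $K$-subalgebra of $P$ generated by $T$. For a subalgebra $B$ of $P$: $B:g^i=\{f\in P\mid g^if\in B\}$ and $B:g^\infty=\bigcup_{i\in\mathbb N}(B:g^i)$. The ideal of relations $\mathrm{Rel}_g(f_1,\dots,f_s)$ of $f_1,\dots,f_s\in P$ modulo $g$ is the kernel of the composition $K[x_1,\dots,x_s]\to P\to P/\langle g\rangle$, where the first map is the $K$-algebra homomorphism with $x_i\mapsto f_i$ and the second is the canonical projection. For $f\in P$, $f:g^\infty$ is the polynomial $f/g^i$, where $g^i$ is the highest power of $g$ dividing $f$; by convention $f:g^\infty=f$ if $f=0$ or $g$ is a constant. For a finitely generated subalgebra $B=K[f_1,\dots,f_s]$ of $P$ with $g\in B\setminus\{0\}$, and a finite set of generators $\{H_1,\dots,H_t\}$ of $\mathrm{Rel}_g(f_1,\dots,f_s)$,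 let $E_g(B)=K[f_1,\dots,f_s,h_1,\dots,h_t]$ where $h_i=H_i(f_1,\dots,f_s):g^\infty$. By abuse of notation $E_g(B)$ is written as depending only on $B$, although it depends on the chosen generators $f_1,\dots,f_s$ of $B$ and $H_1,\dots,H_t$ of the ideal of relations. Put $E_g^0(S)=S$ and recursively $E_g^i(S)=E_g(E_g^{i-1}(S))$ for $i>0$ (with some choice of generators at every step). *)

theory Defs
  imports "HOL-Algebra.Algebra" "HOL-Library.Poly_Mapping" "HOL.Hull"
begin

text \<open>
  Polynomials in the indeterminates with indices in \<open>nat\<close>, as finitely supported functions from
  monomials (finitely supported exponent functions) to coefficients.  The polynomial ring in the
  indeterminates with indices in a set \<open>V\<close> is a \<open>ring\<close> record with the type class operations:
  \<open>mpoly_ring {..n}\<close> is $K[a_0, \ldots, a_n]$, and \<open>mpoly_ring {..<s}\<close> is a polynomial ring in \<open>s\<close>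
  indeterminates, indexed from \<open>0\<close> to \<open>s - 1\<close>.
\<close>

type_synonym 'k mpoly = "(nat \<Rightarrow>\<^sub>0 nat) \<Rightarrow>\<^sub>0 'k"

definition mpoly_ring :: "nat set \<Rightarrow> 'k::field mpoly ring" where
  "mpoly_ring V =
    \<lparr>carrier = {p. \<forall>m\<in>Poly_Mapping.keys p. Poly_Mapping.keys m \<subseteq> V},
     monoid.mult = (*), one = 1, ring.zero = 0, add = (+)\<rparr>"

definition const_poly :: "'k::field \<Rightarrow> 'k mpoly" where
  "const_poly c = Poly_Mapping.single 0 c"

text \<open>
  The image of \<open>H\<close> under the \<open>K\<close>-algebra homomorphism that sends the \<open>i\<close>-th indeterminate to
  \<open>fs ! i\<close>; meaningful for \<open>H\<close> in \<open>mpoly_ring {..<length fs}\<close>.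
\<close>

definition poly_subst :: "'k::field mpoly list \<Rightarrow> 'k mpoly \<Rightarrow> 'k mpoly" where
  "poly_subst fs H =
    (\<Sum>m\<in>Poly_Mapping.keys H. const_poly (Poly_Mapping.lookup H m) *
       (\<Prod>i\<in>Poly_Mapping.keys m. (fs ! i) ^ Poly_Mapping.lookup m i))"

text \<open>
  The locale \<open>subalgebra\<close> of HOL-Algebra only describes linear subspaces; a \<open>K\<close>-subalgebra in the
  usual sense is a subring containing the constants.
\<close>

definition K_subalgebra :: "'k::field mpoly ring \<Rightarrow> 'k mpoly set \<Rightarrow> bool" where
  "K_subalgebra P B \<longleftrightarrow> subring B P \<and> range const_poly \<subseteq> B"

definition generated_algebra :: "'k::field mpoly ring \<Rightarrow> 'k mpoly set \<Rightarrow> 'k mpoly set" where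
  "generated_algebra P T = K_subalgebra P hull T"

definition finitely_generated_algebra :: "'k::field mpoly ring \<Rightarrow> 'k mpoly set \<Rightarrow> bool" where
  "finitely_generated_algebra P B \<longleftrightarrow>
    (\<exists>T. finite T \<and> T \<subseteq> carrier P \<and> B = generated_algebra P T)"

definition colon_pow ::
    "'k::field mpoly ring \<Rightarrow> 'k mpoly set \<Rightarrow> 'k mpoly \<Rightarrow> nat \<Rightarrow> 'k mpoly set" where
  "colon_pow P B g i = {f \<in> carrier P. g ^ i * f \<in> B}"

definition colon_inf :: "'k::field mpoly ring \<Rightarrow> 'k mpoly set \<Rightarrow> 'k mpoly \<Rightarrow> 'k mpoly set" where
  "colon_inf P B g = (\<Union>i. colon_pow P B g i)"

text \<open>
  The kernel of $K[x_1, \ldots, x_s] \to P \to P / \langle g\rangle$, where \<open>s\<close> is the length of \<open>fs\<close>.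
\<close>

definition Rel :: "'k::field mpoly ring \<Rightarrow> 'k mpoly \<Rightarrow> 'k mpoly list \<Rightarrow> 'k mpoly set" where
  "Rel P g fs =
    a_kernel (mpoly_ring {..<length fs}) (P Quot (Idl\<^bsub>P\<^esub> {g}))
      (\<lambda>H. (Idl\<^bsub>P\<^esub> {g}) +>\<^bsub>P\<^esub> poly_subst fs H)"

definition poly_sat :: "'k::field mpoly ring \<Rightarrow> 'k mpoly \<Rightarrow> 'k mpoly \<Rightarrow> 'k mpoly" where
  "poly_sat P f g =
    (if f = 0 \<or> g \<in> range const_poly then f
     else THE q. q \<in> carrier P \<and> f = g ^ (GREATEST i. g ^ i divides\<^bsub>P\<^esub> f) * q)"

text \<open>
  \<open>is_E P g B C\<close>: the algebra \<open>C\<close> arises as $E_g(B)$ for some generators \<open>fs\<close> of \<open>B\<close> and some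
  finite set \<open>Hs\<close> of generators of the ideal of relations.  A relation is used because the result
  depends on these choices.
\<close>

definition is_E ::
    "'k::field mpoly ring \<Rightarrow> 'k mpoly \<Rightarrow> 'k mpoly set \<Rightarrow> 'k mpoly set \<Rightarrow> bool" where
  "is_E P g B C \<longleftrightarrow> g \<in> B - {0} \<and>
    (\<exists>fs Hs. set fs \<subseteq> carrier P \<and> B = generated_algebra P (set fs) \<and>
       finite Hs \<and> Hs \<subseteq> carrier (mpoly_ring {..<length fs}) \<and>
       Idl\<^bsub>mpoly_ring {..<length fs}\<^esub> Hs = Rel P g fs \<and>
       C = generated_algebra P (set fs \<union> (\<lambda>H. poly_sat P (poly_subst fs H) g) ` Hs))"

text \<open>
  \<open>E 0, \<dots>, E i\<close> are the iterates $E_g^0(S), \ldots, E_g^i(S)$ for some choice of generators at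
  every step.
\<close>

definition E_iterates ::
    "'k::field mpoly ring \<Rightarrow> 'k mpoly \<Rightarrow> 'k mpoly set \<Rightarrow> nat \<Rightarrow> (nat \<Rightarrow> 'k mpoly set) \<Rightarrow> bool" where
  "E_iterates P g S i E \<longleftrightarrow> E 0 = S \<and> (\<forall>j<i. is_E P g (E j) (E (Suc j)))"

end

theory Submission
  imports Defs
begin

text \<open>
  Everything rests on one step of the construction.  If \<open>C\<close> arises as $E_g(B)$ from generators
  \<open>fs\<close> of \<open>B\<close> and generators \<open>Hs\<close> of the ideal of relations, then
  $B \subseteq C \subseteq B : g^\infty$ and every \<open>f\<close> with $g f \in B$ lies in \<open>C\<close>.

  The first claim holds because each new generator, multiplied by some power of \<open>g\<close>, is the value
  at \<open>fs\<close> of a polynomial, hence an element of \<open>B\<close>, and $B : g^\infty$ is an algebra since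
  $g \in B$.  For the second claim let \<open>g\<close> be nonconstant (a constant \<open>g\<close> is invertible in
  \<open>B\<close>).  The polynomials $H$ whose value at \<open>fs\<close> lies in $g C$ form an ideal \<open>J\<close>.  It contains
  every \<open>H\<close> in \<open>Hs\<close>: the value of \<open>H\<close> is divisible by \<open>g\<close>, so it is $0$ or equals $g^k h$ with
  the new generator $h$ and with $k \ge 1$.  Hence \<open>J\<close> contains all relations.  If $g f \in B$, then
  $g f$ is the value of a relation, so $g f = g c$ with $c \in C$, and $f = c$ by cancellation.
  These facts are collected in \<open>is_E_subset\<close>.

  By induction, $S : g^i \subseteq E_g^i(S) \subseteq S : g^\infty$: an element \<open>f\<close> of
  $S : g^{i+1}$ satisfies $g f \in S : g^i$, and $(S : g^\infty) : g^\infty = S : g^\infty$.  The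
  latter also gives $A : g^\infty = S : g^\infty$.  If $E_g(A) = A$, then $g f \in A$ implies
  $f \in A$ for every \<open>f\<close> in \<open>P\<close>, so $A = A : g^\infty$.

  The exponent that defines $f : g^\infty$ exists because leading monomials with respect to the
  lexicographic order are additive (\<open>Max_keys_mult\<close>), which bounds the powers of a nonconstant
  \<open>g\<close> that divide a nonzero polynomial (\<open>nonconst_power_dvd_bounded\<close>).
\<close>

section \<open>Polynomial rings and their subalgebras\<close>

lemma mpoly_ring_simps [simp]:
  "x \<otimes>\<^bsub>mpoly_ring V\<^esub> y = x * y" "x \<oplus>\<^bsub>mpoly_ring V\<^esub> y = x + y"
  "\<one>\<^bsub>mpoly_ring V\<^esub> = 1" "\<zero>\<^bsub>mpoly_ring V\<^esub> = 0"
  by (simp_all add: mpoly_ring_def)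

lemma mem_carrier_mpoly_ring:
  "p \<in> carrier (mpoly_ring V) \<longleftrightarrow> (\<forall>m\<in>Poly_Mapping.keys p. Poly_Mapping.keys m \<subseteq> V)"
  by (simp add: mpoly_ring_def)

lemma mpoly_ring_closed:
  shows "x \<in> carrier (mpoly_ring V) \<Longrightarrow> y \<in> carrier (mpoly_ring V) \<Longrightarrow> x + y \<in> carrier (mpoly_ring V)"
    and "x \<in> carrier (mpoly_ring V) \<Longrightarrow> y \<in> carrier (mpoly_ring V) \<Longrightarrow> x * y \<in> carrier (mpoly_ring V)"
    and "x \<in> carrier (mpoly_ring V) \<Longrightarrow> - x \<in> carrier (mpoly_ring V)"
    and const_poly_carrier: "const_poly c \<in> carrier (mpoly_ring V)"
proof -
  show "x + y \<in> carrier (mpoly_ring V)"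
    if "x \<in> carrier (mpoly_ring V)" "y \<in> carrier (mpoly_ring V)"
    using that Poly_Mapping.keys_add[of x y] unfolding mem_carrier_mpoly_ring by blast
  show "- x \<in> carrier (mpoly_ring V)" if "x \<in> carrier (mpoly_ring V)"
    using that by (simp add: mem_carrier_mpoly_ring in_keys_iff)
  show "const_poly c \<in> carrier (mpoly_ring V)"
    by (simp add: mem_carrier_mpoly_ring const_poly_def)
  show "x * y \<in> carrier (mpoly_ring V)"
    if "x \<in> carrier (mpoly_ring V)" "y \<in> carrier (mpoly_ring V)"
    unfolding mem_carrier_mpoly_ring
  proof
    fix m assume "m \<in> Poly_Mapping.keys (x * y)"
    then obtain a b where ab: "a \<in> Poly_Mapping.keys x" "b \<in> Poly_Mapping.keys y" "m = a + b"
      using keys_mult[of x y] by blast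
    then show "Poly_Mapping.keys m \<subseteq> V"
      using that Poly_Mapping.keys_add[of a b] unfolding mem_carrier_mpoly_ring by blast
  qed
qed

lemma const_poly_simps:
  "const_poly 0 = 0" "const_poly 1 = 1" "const_poly (c + d) = const_poly c + const_poly d"
  "const_poly (c * d) = const_poly c * const_poly d" "const_poly (- c) = - const_poly c"
  by (simp_all add: const_poly_def single_add mult_single single_uminus)

lemma one_carrier_mpoly_ring: "1 \<in> carrier (mpoly_ring V)"
  and zero_carrier_mpoly_ring: "0 \<in> carrier (mpoly_ring V)"
  by (simp_all add: mem_carrier_mpoly_ring)

lemma cring_mpoly_ring: "cring (mpoly_ring V :: 'k::field mpoly ring)"
proof (rule cringI)
  show "abelian_group (mpoly_ring V :: 'k mpoly ring)"
  proof (rule abelian_groupI)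
    fix x :: "'k mpoly" assume "x \<in> carrier (mpoly_ring V)"
    then show "\<exists>y\<in>carrier (mpoly_ring V). y \<oplus>\<^bsub>mpoly_ring V\<^esub> x = \<zero>\<^bsub>mpoly_ring V\<^esub>"
      by (intro bexI[of _ "- x"]) (auto intro: mpoly_ring_closed)
  qed (auto intro: mpoly_ring_closed one_carrier_mpoly_ring zero_carrier_mpoly_ring)
  show "Group.comm_monoid (mpoly_ring V :: 'k mpoly ring)"
    by (rule comm_monoidI) (auto intro: mpoly_ring_closed one_carrier_mpoly_ring)
qed (auto simp: algebra_simps)

lemma K_subalgebra_iff:
  fixes B :: "'k::field mpoly set"
  shows "K_subalgebra (mpoly_ring V) B \<longleftrightarrow>
    B \<subseteq> carrier (mpoly_ring V) \<and> range const_poly \<subseteq> B \<and>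
    (\<forall>x\<in>B. \<forall>y\<in>B. x + y \<in> B \<and> x * y \<in> B)"
    (is "?L \<longleftrightarrow> ?R")
proof -
  interpret cring "mpoly_ring V :: 'k mpoly ring" by (rule cring_mpoly_ring)
  show ?thesis
  proof
    assume ?L
    then show ?R
      unfolding K_subalgebra_def
      using subringE(1,6,7)[of B "mpoly_ring V"] by auto
  next
    assume R: ?R
    have "subring B (mpoly_ring V)"
    proof (rule subringI)
      show "\<one>\<^bsub>mpoly_ring V\<^esub> \<in> B"
        using R const_poly_simps(2) by (metis mpoly_ring_simps(3) rangeI subsetD)
      fix x assume x: "x \<in> B"
      have "\<ominus>\<^bsub>mpoly_ring V\<^esub> x = const_poly (- 1) * x"
        using x R by (intro minus_equality) (auto simp: const_poly_simps mpoly_ring_closed)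
      then show "\<ominus>\<^bsub>mpoly_ring V\<^esub> x \<in> B"
        using x R by (metis rangeI subsetD)
    qed (use R in auto)
    then show ?L
      using R by (simp add: K_subalgebra_def)
  qed
qed

lemma K_subalgebraD:
  assumes "K_subalgebra (mpoly_ring V) B"
  shows K_subalgebra_subset: "B \<subseteq> carrier (mpoly_ring V)"
    and K_subalgebra_const: "const_poly c \<in> B"
    and K_subalgebra_zero: "0 \<in> B"
    and K_subalgebra_one: "1 \<in> B"
    and K_subalgebra_add: "x \<in> B \<Longrightarrow> y \<in> B \<Longrightarrow> x + y \<in> B"
    and K_subalgebra_mult: "x \<in> B \<Longrightarrow> y \<in> B \<Longrightarrow> x * y \<in> B"
    and K_subalgebra_power: "x \<in> B \<Longrightarrow> x ^ i \<in> B"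
proof -
  note B = assms[unfolded K_subalgebra_iff]
  show c: "const_poly c \<in> B" for c using B by auto
  show "B \<subseteq> carrier (mpoly_ring V)" "x \<in> B \<Longrightarrow> y \<in> B \<Longrightarrow> x + y \<in> B"
    "x \<in> B \<Longrightarrow> y \<in> B \<Longrightarrow> x * y \<in> B"
    using B by auto
  show "0 \<in> B" and one: "1 \<in> B"
    using c[of 0] c[of 1] by (simp_all add: const_poly_simps)
  show "x ^ i \<in> B" if "x \<in> B"
    using that B one by (induction i) auto
qed

lemma K_subalgebra_carrier: "K_subalgebra (mpoly_ring V) (carrier (mpoly_ring V))"
  by (auto simp: K_subalgebra_iff intro: mpoly_ring_closed const_poly_carrier)

lemma generated_algebra_superset: "T \<subseteq> generated_algebra P T"
  unfolding generated_algebra_def by (rule hull_subset)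

lemma generated_algebra_least:
  "T \<subseteq> B \<Longrightarrow> K_subalgebra P B \<Longrightarrow> generated_algebra P T \<subseteq> B"
  unfolding generated_algebra_def by (rule hull_minimal)

lemma K_subalgebra_generated:
  assumes "T \<subseteq> carrier (mpoly_ring V)"
  shows "K_subalgebra (mpoly_ring V) (generated_algebra (mpoly_ring V) T)"
proof -
  have "generated_algebra (mpoly_ring V) T \<subseteq> carrier (mpoly_ring V)"
    by (rule generated_algebra_least[OF assms K_subalgebra_carrier])
  then show ?thesis
    unfolding K_subalgebra_iff
    by (auto simp: generated_algebra_def hull_def K_subalgebra_iff)
qed

section \<open>Substitution\<close>

lemma poly_subst_superset:
  assumes "finite A" "Poly_Mapping.keys H \<subseteq> A"
  shows "poly_subst fs H = (\<Sum>m\<in>A. const_poly (Poly_Mapping.lookup H m) *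
       (\<Prod>i\<in>Poly_Mapping.keys m. (fs ! i) ^ Poly_Mapping.lookup m i))"
  unfolding poly_subst_def using assms
  by (intro sum.mono_neutral_left) (auto simp: in_keys_iff const_poly_simps)

lemma poly_subst_add: "poly_subst fs (H + G) = poly_subst fs H + poly_subst fs G"
proof -
  let ?A = "Poly_Mapping.keys H \<union> Poly_Mapping.keys G"
  have fin: "finite ?A" by simp
  show ?thesis
    using Poly_Mapping.keys_add[of H G]
    by (simp add: poly_subst_superset[OF fin] lookup_add const_poly_simps distrib_right sum.distrib)
qed

lemma poly_subst_zero [simp]: "poly_subst fs 0 = 0"
  by (simp add: poly_subst_def)

lemma poly_subst_sum: "poly_subst fs (\<Sum>x\<in>A. f x) = (\<Sum>x\<in>A. poly_subst fs (f x))"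
  by (induction A rule: infinite_finite_induct) (simp_all add: poly_subst_add)

lemma poly_subst_single:
  "poly_subst fs (Poly_Mapping.single m c) = const_poly c *
     (\<Prod>i\<in>Poly_Mapping.keys m. (fs ! i) ^ Poly_Mapping.lookup m i)"
  by (subst poly_subst_superset[of "{m}"]) auto

lemma prod_power_keys_add:
  fixes x :: "'a \<Rightarrow> 'b::comm_semiring_1" and m k :: "'a \<Rightarrow>\<^sub>0 nat"
  shows "(\<Prod>i\<in>Poly_Mapping.keys (m + k). x i ^ Poly_Mapping.lookup (m + k) i) =
    (\<Prod>i\<in>Poly_Mapping.keys m. x i ^ Poly_Mapping.lookup m i) *
    (\<Prod>i\<in>Poly_Mapping.keys k. x i ^ Poly_Mapping.lookup k i)"
proof -
  let ?A = "Poly_Mapping.keys m \<union> Poly_Mapping.keys k"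
  have *: "(\<Prod>i\<in>Poly_Mapping.keys p. x i ^ Poly_Mapping.lookup p i) =
      (\<Prod>i\<in>?A. x i ^ Poly_Mapping.lookup p i)" if "Poly_Mapping.keys p \<subseteq> ?A" for p
    using that by (intro prod.mono_neutral_left) (auto simp: in_keys_iff)
  show ?thesis
    unfolding *[OF Poly_Mapping.keys_add] *[OF Un_upper1] *[OF Un_upper2]
    by (simp add: lookup_add power_add prod.distrib)
qed

lemma poly_mapping_sum_single:
  "(\<Sum>m\<in>Poly_Mapping.keys p. Poly_Mapping.single m (Poly_Mapping.lookup p m)) = p"
  by (rule poly_mapping_eqI) (auto simp: lookup_sum lookup_single when_def in_keys_iff)

text \<open>
  Multiplicativity holds for all arguments: when an indeterminate has no entry in \<open>fs\<close>, the
  unspecified value \<open>fs ! i\<close> is substituted for it.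
\<close>

lemma poly_subst_mult: "poly_subst fs (H * G) = poly_subst fs H * poly_subst fs G"
proof -
  let ?s = "\<lambda>p m. Poly_Mapping.single m (Poly_Mapping.lookup p m)"
  have "H * G = (\<Sum>m\<in>Poly_Mapping.keys H. \<Sum>k\<in>Poly_Mapping.keys G. ?s H m * ?s G k)"
    by (simp add: poly_mapping_sum_single flip: sum_product)
  also have "poly_subst fs \<dots> =
      (\<Sum>m\<in>Poly_Mapping.keys H. \<Sum>k\<in>Poly_Mapping.keys G.
         poly_subst fs (?s H m) * poly_subst fs (?s G k))"
    by (simp add: poly_subst_sum mult_single poly_subst_single prod_power_keys_add
        const_poly_simps mult_ac)
  also have "\<dots> = poly_subst fs (\<Sum>m\<in>Poly_Mapping.keys H. ?s H m) *
      poly_subst fs (\<Sum>m\<in>Poly_Mapping.keys G. ?s G m)"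
    by (simp add: poly_subst_sum sum_product)
  finally show ?thesis by (simp add: poly_mapping_sum_single)
qed

lemma poly_subst_in_subalgebra:
  assumes B: "K_subalgebra (mpoly_ring V) B" and fs: "set fs \<subseteq> B"
    and H: "H \<in> carrier (mpoly_ring {..<length fs})"
  shows "poly_subst fs H \<in> B"
proof -
  have prod: "(\<Prod>x\<in>A. f x) \<in> B" if "\<And>x. x \<in> A \<Longrightarrow> f x \<in> B" for A and f :: "nat \<Rightarrow> 'a mpoly"
    using that by (induction A rule: infinite_finite_induct)
      (auto intro: K_subalgebra_mult[OF B] K_subalgebra_one[OF B])
  have sum: "(\<Sum>x\<in>A. f x) \<in> B" if "\<And>x. x \<in> A \<Longrightarrow> f x \<in> B"
    for A and f :: "(nat \<Rightarrow>\<^sub>0 nat) \<Rightarrow> 'a mpoly"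
    using that by (induction A rule: infinite_finite_induct)
      (auto intro: K_subalgebra_add[OF B] K_subalgebra_zero[OF B])
  have "fs ! i \<in> B" if "m \<in> Poly_Mapping.keys H" "i \<in> Poly_Mapping.keys m" for m i
    using H that fs unfolding mem_carrier_mpoly_ring by force
  then show ?thesis
    unfolding poly_subst_def
    by (intro sum prod K_subalgebra_mult[OF B] K_subalgebra_const[OF B] K_subalgebra_power[OF B])
qed

lemma generated_algebra_eq_image:
  assumes fs: "set fs \<subseteq> carrier (mpoly_ring V)"
  shows "generated_algebra (mpoly_ring V) (set fs) =
    poly_subst fs ` carrier (mpoly_ring {..<length fs})" (is "?B = ?I")
proof
  have "K_subalgebra (mpoly_ring V) ?I"
    unfolding K_subalgebra_iff
  proof (intro conjI ballI)
    show "?I \<subseteq> carrier (mpoly_ring V)"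
      using poly_subst_in_subalgebra[OF K_subalgebra_carrier fs] by blast
    show "range const_poly \<subseteq> ?I"
    proof (rule subsetI, erule rangeE)
      fix x and c :: 'a assume "x = const_poly c"
      then have "x = poly_subst fs (const_poly c)"
        by (simp add: const_poly_def poly_subst_single)
      then show "x \<in> ?I" by (simp add: const_poly_carrier)
    qed
    fix x y assume "x \<in> ?I" "y \<in> ?I"
    then obtain H G where "x = poly_subst fs H" "H \<in> carrier (mpoly_ring {..<length fs})"
      "y = poly_subst fs G" "G \<in> carrier (mpoly_ring {..<length fs})" by blast
    then show "x + y \<in> ?I" "x * y \<in> ?I"
      by (auto simp flip: poly_subst_add poly_subst_mult intro!: imageI mpoly_ring_closed)
  qed
  moreover have "set fs \<subseteq> ?I"
  proof
    fix x assume "x \<in> set fs"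
    then obtain i where i: "i < length fs" "x = fs ! i" by (auto simp: in_set_conv_nth)
    let ?X = "Poly_Mapping.single (Poly_Mapping.single i (1::nat)) (1::'a)"
    have "x = poly_subst fs ?X"
      using i by (simp add: poly_subst_single const_poly_simps)
    moreover have "?X \<in> carrier (mpoly_ring {..<length fs})"
      using i by (simp add: mem_carrier_mpoly_ring)
    ultimately show "x \<in> ?I" by blast
  qed
  ultimately show "?B \<subseteq> ?I" by (intro generated_algebra_least)
  show "?I \<subseteq> ?B"
    using poly_subst_in_subalgebra[OF K_subalgebra_generated[OF fs] generated_algebra_superset]
    by blast
qed

section \<open>Leading monomials and saturation of a polynomial\<close>

text \<open>
  Exponent functions carry a lexicographic linear order compatible with addition, so
  \<open>Max (Poly_Mapping.keys p)\<close> is the leading monomial of \<open>p\<close>.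
\<close>

lemma Max_keys_mult:
  fixes p q :: "'k::field mpoly"
  assumes "p \<noteq> 0" "q \<noteq> 0"
  shows "Max (Poly_Mapping.keys (p * q)) = Max (Poly_Mapping.keys p) + Max (Poly_Mapping.keys q)"
proof -
  let ?a = "Max (Poly_Mapping.keys p)" and ?b = "Max (Poly_Mapping.keys q)"
  have a: "?a \<in> Poly_Mapping.keys p" and b: "?b \<in> Poly_Mapping.keys q"
    using assms by (auto intro!: Max_in)
  have le_a: "m \<le> ?a" if "m \<in> Poly_Mapping.keys p" for m using that by simp
  have le_b: "m \<le> ?b" if "m \<in> Poly_Mapping.keys q" for m using that by simp
  \<comment> \<open>Only one pair of monomials contributes to the coefficient of the product at \<open>?a + ?b\<close>.\<close>
  have eq: "m = ?a \<and> k = ?b"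
    if "m \<in> Poly_Mapping.keys p" "k \<in> Poly_Mapping.keys q" "?a + ?b = m + k" for m k
    using le_a[OF that(1)] le_b[OF that(2)] that(3)
    by (metis add_le_less_mono add_less_le_mono order.not_eq_order_implies_strict order_less_irrefl)
  have inner: "Sum_any (\<lambda>k. Poly_Mapping.lookup q k when ?a + ?b = m + k) =
      (Poly_Mapping.lookup q ?b when m = ?a)" if "m \<in> Poly_Mapping.keys p" for m
  proof -
    have "(Poly_Mapping.lookup q k when ?a + ?b = m + k) =
      ((Poly_Mapping.lookup q ?b when m = ?a) when k = ?b)" for k
      using eq[OF that, of k] by (auto simp: when_def in_keys_iff)
    then show ?thesis by simp
  qed
  have "Poly_Mapping.lookup (p * q) (?a + ?b) = Sum_any (\<lambda>m. Poly_Mapping.lookup p m *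
      Sum_any (\<lambda>k. Poly_Mapping.lookup q k when ?a + ?b = m + k))"
    by (simp add: lookup_mult)
  also have "\<dots> = Sum_any (\<lambda>m. Poly_Mapping.lookup p ?a * Poly_Mapping.lookup q ?b when m = ?a)"
  proof (rule Sum_any.cong)
    fix m
    show "Poly_Mapping.lookup p m * Sum_any (\<lambda>k. Poly_Mapping.lookup q k when ?a + ?b = m + k) =
      (Poly_Mapping.lookup p ?a * Poly_Mapping.lookup q ?b when m = ?a)"
      using inner[of m] a
      by (cases "m \<in> Poly_Mapping.keys p") (auto simp: in_keys_iff when_def)
  qed
  also have "\<dots> = Poly_Mapping.lookup p ?a * Poly_Mapping.lookup q ?b" by simp
  finally have "Poly_Mapping.lookup (p * q) (?a + ?b) \<noteq> 0"
    using a b by (simp add: in_keys_iff)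
  then have "?a + ?b \<in> Poly_Mapping.keys (p * q)" by (simp add: in_keys_iff)
  moreover have "m \<le> ?a + ?b" if "m \<in> Poly_Mapping.keys (p * q)" for m
    using that keys_mult[of p q] le_a le_b by (fastforce intro: add_mono)
  ultimately show ?thesis by (intro Max_eqI) auto
qed

lemma zero_le_exponent: "(0 :: nat \<Rightarrow>\<^sub>0 nat) \<le> m"
proof -
  have "\<not> m < 0"
    by (transfer) (auto simp: less_fun_def)
  then show ?thesis by simp
qed

lemma Max_keys_nonconst:
  fixes g :: "'k::field mpoly"
  assumes "g \<notin> range const_poly"
  shows "Max (Poly_Mapping.keys g) \<noteq> 0"
proof
  assume max: "Max (Poly_Mapping.keys g) = 0"
  have "m = 0" if "m \<in> Poly_Mapping.keys g" for m
    using Max_ge[OF finite_keys that] max zero_le_exponent[of m] by (metis order.antisym)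
  then have "Poly_Mapping.keys g \<subseteq> {0}" by auto
  then have "g = const_poly (Poly_Mapping.lookup g 0)"
    unfolding const_poly_def
    by (intro poly_mapping_eqI) (auto simp: lookup_single when_def in_keys_iff)
  then show False using assms by blast
qed

lemma nonconst_power_dvd_bounded:
  fixes f g :: "'k::field mpoly"
  assumes "f \<noteq> 0" "g \<notin> range const_poly"
  shows "\<exists>b. \<forall>i q. f = g ^ i * q \<longrightarrow> i \<le> b"
proof -
  have g0: "g \<noteq> 0"
    using assms(2) const_poly_simps(1) by (metis rangeI)
  \<comment> \<open>An indeterminate that occurs in the leading monomial of \<open>g\<close>: each factor \<open>g\<close> contributes
      to its exponent in the leading monomial of \<open>f\<close>.\<close>
  obtain v where v: "Poly_Mapping.lookup (Max (Poly_Mapping.keys g)) v \<noteq> 0"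
    using Max_keys_nonconst[OF assms(2)] by (metis poly_mapping_eqI lookup_zero)
  have pow: "i \<le> Poly_Mapping.lookup (Max (Poly_Mapping.keys (g ^ i))) v" for i
  proof (induction i)
    case (Suc i)
    then show ?case
      using v g0 by (simp add: Max_keys_mult lookup_add)
  qed simp
  have "i \<le> Poly_Mapping.lookup (Max (Poly_Mapping.keys f)) v" if "f = g ^ i * q" for i q
    using pow[of i] that assms(1) by (auto simp: Max_keys_mult lookup_add)
  then show ?thesis by blast
qed

text \<open>
  The exponent \<open>k\<close> is the highest one for which the power of \<open>g\<close> divides \<open>f\<close>; the quotient is unique
  by cancellation, so the definite description in \<open>poly_sat\<close> denotes it.
\<close>

lemma poly_sat_nonconst:
  assumes f: "f \<in> carrier (mpoly_ring V)" "f \<noteq> 0"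
    and g: "g \<in> carrier (mpoly_ring V)" "g \<notin> range const_poly"
  obtains k where "poly_sat (mpoly_ring V) f g \<in> carrier (mpoly_ring V)"
    and "f = g ^ k * poly_sat (mpoly_ring V) f g"
    and "\<And>j q. q \<in> carrier (mpoly_ring V) \<Longrightarrow> f = g ^ j * q \<Longrightarrow> j \<le> k"
proof -
  let ?P = "mpoly_ring V"
  define D where "D i \<longleftrightarrow> g ^ i divides\<^bsub>?P\<^esub> f" for i :: nat
  have D: "D i \<longleftrightarrow> (\<exists>q\<in>carrier ?P. f = g ^ i * q)" for i
    by (simp add: D_def factor_def)
  obtain b where b: "\<And>i. D i \<Longrightarrow> i \<le> b"
    using nonconst_power_dvd_bounded[OF f(2) g(2)] D by metis
  have "D 0" using f D by auto
  let ?k = "GREATEST i. D i"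
  have "D ?k" by (rule GreatestI_nat[of D 0 b]) (use b \<open>D 0\<close> in auto)
  then obtain q where q: "q \<in> carrier ?P" "f = g ^ ?k * q" using D by blast
  have "poly_sat ?P f g = (THE q. q \<in> carrier ?P \<and> f = g ^ ?k * q)"
    using f g by (simp add: poly_sat_def D_def)
  also have "\<dots> = q"
  proof (rule the_equality)
    fix q' assume "q' \<in> carrier ?P \<and> f = g ^ ?k * q'"
    then show "q' = q" using q f(2) by (metis mult_left_cancel mult_zero_left)
  qed (use q in simp)
  finally have "poly_sat ?P f g = q" .
  with q show ?thesis
  proof (intro that[of ?k])
    fix j q assume "q \<in> carrier ?P" "f = g ^ j * q"
    then have "D j" using D by blast
    then show "j \<le> ?k" by (rule Greatest_le_nat[of D j b]) (use b in auto)
  qed auto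
qed

lemma poly_sat_power_mult:
  assumes "f \<in> carrier (mpoly_ring V)" "g \<in> carrier (mpoly_ring V)"
  shows "poly_sat (mpoly_ring V) f g \<in> carrier (mpoly_ring V)"
    and "\<exists>k. f = g ^ k * poly_sat (mpoly_ring V) f g"
proof -
  have "poly_sat (mpoly_ring V) f g \<in> carrier (mpoly_ring V) \<and>
    (\<exists>k. f = g ^ k * poly_sat (mpoly_ring V) f g)"
  proof (cases "f = 0 \<or> g \<in> range const_poly")
    case True
    then show ?thesis using assms by (auto simp: poly_sat_def intro!: exI[of _ 0])
  next
    case False
    then show ?thesis using poly_sat_nonconst[OF assms(1) _ assms(2)] by metis
  qed
  then show "poly_sat (mpoly_ring V) f g \<in> carrier (mpoly_ring V)"
    and "\<exists>k. f = g ^ k * poly_sat (mpoly_ring V) f g" by auto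
qed

section \<open>Relations modulo a polynomial and colon algebras\<close>

lemma Rel_iff:
  fixes fs :: "'k::field mpoly list"
  assumes g: "g \<in> carrier (mpoly_ring V)" and fs: "set fs \<subseteq> carrier (mpoly_ring V)"
  shows "H \<in> Rel (mpoly_ring V) g fs \<longleftrightarrow> H \<in> carrier (mpoly_ring {..<length fs}) \<and>
    (\<exists>q\<in>carrier (mpoly_ring V). poly_subst fs H = g * q)"
proof -
  let ?P = "mpoly_ring V :: 'k mpoly ring"
  let ?I = "Idl\<^bsub>?P\<^esub> {g}"
  interpret cring ?P by (rule cring_mpoly_ring)
  have I: "ideal ?I ?P" using g by (intro genideal_ideal) simp
  have coset: "?I +>\<^bsub>?P\<^esub> x = ?I \<longleftrightarrow> (\<exists>q\<in>carrier ?P. x = g * q)"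
    if x: "x \<in> carrier ?P" for x
  proof -
    have "?I +>\<^bsub>?P\<^esub> x = ?I \<longleftrightarrow> x \<in> ?I"
      using ideal.rcos_const_imp_mem[OF I x] a_rcos_zero[OF I] by blast
    also have "\<dots> \<longleftrightarrow> x \<in> PIdl\<^bsub>?P\<^esub> g" using cgenideal_eq_genideal[OF g] by simp
    also have "\<dots> \<longleftrightarrow> (\<exists>q\<in>carrier ?P. x = g * q)" by (auto simp: cgenideal_def mult.commute)
    finally show ?thesis .
  qed
  have "poly_subst fs H \<in> carrier ?P" if "H \<in> carrier (mpoly_ring {..<length fs})"
    using poly_subst_in_subalgebra[OF K_subalgebra_carrier fs that] .
  then show ?thesis
    unfolding Rel_def a_kernel_def' FactRing_def using coset by auto
qed

lemma colon_infI:
  "f \<in> carrier P \<Longrightarrow> g ^ i * f \<in> B \<Longrightarrow> f \<in> colon_inf P B g"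
  by (auto simp: colon_inf_def colon_pow_def)

lemma colon_infE:
  assumes "f \<in> colon_inf P B g"
  obtains i where "f \<in> carrier P" "g ^ i * f \<in> B"
  using assms by (auto simp: colon_inf_def colon_pow_def)

lemma K_subalgebra_colon_inf:
  fixes B :: "'k::field mpoly set"
  assumes B: "K_subalgebra (mpoly_ring V) B" and g: "g \<in> B"
  shows "K_subalgebra (mpoly_ring V) (colon_inf (mpoly_ring V) B g)"
  unfolding K_subalgebra_iff
proof (intro conjI ballI)
  note clB = K_subalgebraD[OF B]
  show "colon_inf (mpoly_ring V) B g \<subseteq> carrier (mpoly_ring V)"
    by (auto simp: colon_inf_def colon_pow_def)
  show "range const_poly \<subseteq> colon_inf (mpoly_ring V) B g"
    using clB(2) by (auto intro: colon_infI[where i = 0] const_poly_carrier)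
  fix x y
  assume "x \<in> colon_inf (mpoly_ring V) B g" "y \<in> colon_inf (mpoly_ring V) B g"
  then obtain i j where x: "x \<in> carrier (mpoly_ring V)" "g ^ i * x \<in> B"
    and y: "y \<in> carrier (mpoly_ring V)" "g ^ j * y \<in> B"
    by (elim colon_infE)
  have "g ^ (i + j) * (x + y) = g ^ j * (g ^ i * x) + g ^ i * (g ^ j * y)"
    by (simp add: power_add algebra_simps)
  also have "\<dots> \<in> B" by (intro clB x y g)
  finally have "g ^ (i + j) * (x + y) \<in> B" .
  then show "x + y \<in> colon_inf (mpoly_ring V) B g"
    using x(1) y(1) by (intro colon_infI mpoly_ring_closed)
  have "g ^ (i + j) * (x * y) = (g ^ i * x) * (g ^ j * y)"
    by (simp add: power_add algebra_simps)
  also have "\<dots> \<in> B" using x y clB by blast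
  finally show "x * y \<in> colon_inf (mpoly_ring V) B g"
    using x(1) y(1) by (intro colon_infI mpoly_ring_closed)
qed

lemma subset_colon_inf:
  assumes "K_subalgebra (mpoly_ring V) B"
  shows "B \<subseteq> colon_inf (mpoly_ring V) B g"
  using K_subalgebra_subset[OF assms] by (auto intro: colon_infI[where i = 0])

lemma colon_inf_mono:
  assumes "B \<subseteq> C" shows "colon_inf P B g \<subseteq> colon_inf P C g"
  using assms by (auto simp: colon_inf_def colon_pow_def)

lemma colon_inf_idem:
  "colon_inf P (colon_inf P B g) g \<subseteq> colon_inf P B g"
proof
  fix f assume "f \<in> colon_inf P (colon_inf P B g) g"
  then obtain i j where "f \<in> carrier P" "g ^ j * (g ^ i * f) \<in> B"
    by (elim colon_infE)
  then show "f \<in> colon_inf P B g"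
    by (intro colon_infI[where i = "j + i"]) (simp_all add: power_add mult.assoc)
qed

lemma colon_pow_Suc:
  assumes "g \<in> carrier (mpoly_ring V)"
  shows "f \<in> colon_pow (mpoly_ring V) B g (Suc i) \<longleftrightarrow>
    f \<in> carrier (mpoly_ring V) \<and> g * f \<in> colon_pow (mpoly_ring V) B g i"
  using assms by (auto simp: colon_pow_def mpoly_ring_closed mult.assoc power_Suc2
      simp del: power_Suc)

section \<open>The algebra generated by saturated relations\<close>

lemma is_E_subset:
  fixes V :: "nat set"
  defines "P \<equiv> mpoly_ring V"
  assumes E: "is_E P g B C"
  shows is_E_subalgebra: "K_subalgebra P B" "K_subalgebra P C"
    and is_E_mono: "B \<subseteq> C"
    and is_E_colon_inf: "C \<subseteq> colon_inf P B g"
    and is_E_colon: "\<And>f. f \<in> carrier P \<Longrightarrow> g * f \<in> B \<Longrightarrow> f \<in> C"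
proof -
  from E obtain fs Hs where gB: "g \<in> B" and g0: "g \<noteq> 0" and fs: "set fs \<subseteq> carrier P"
    and Bgen: "B = generated_algebra P (set fs)"
    and Hs: "Hs \<subseteq> carrier (mpoly_ring {..<length fs})"
    and Idl: "Idl\<^bsub>mpoly_ring {..<length fs}\<^esub> Hs = Rel P g fs"
    and Cgen: "C = generated_algebra P (set fs \<union> (\<lambda>H. poly_sat P (poly_subst fs H) g) ` Hs)"
    by (auto simp: is_E_def)
  let ?R = "mpoly_ring {..<length fs} :: 'a mpoly ring"
  interpret R: cring ?R by (rule cring_mpoly_ring)
  show B: "K_subalgebra P B"
    unfolding Bgen P_def by (rule K_subalgebra_generated[OF fs[unfolded P_def]])
  have gP: "g \<in> carrier P" using gB K_subalgebra_subset B P_def by blast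
  have Bim: "B = poly_subst fs ` carrier ?R"
    unfolding Bgen P_def by (rule generated_algebra_eq_image[OF fs[unfolded P_def]])
  have substP: "poly_subst fs H \<in> carrier P" if "H \<in> carrier ?R" for H
    using that Bim K_subalgebra_subset[OF B[unfolded P_def]] unfolding P_def by blast
  have sat: "poly_sat P (poly_subst fs H) g \<in> carrier P"
    "\<exists>k. poly_subst fs H = g ^ k * poly_sat P (poly_subst fs H) g" if "H \<in> carrier ?R" for H
    using poly_sat_power_mult[OF substP[OF that, unfolded P_def] gP[unfolded P_def]]
    unfolding P_def by auto
  have gens: "set fs \<union> (\<lambda>H. poly_sat P (poly_subst fs H) g) ` Hs \<subseteq> carrier P"
    using fs Hs sat(1) by blast
  show C: "K_subalgebra P C"
    unfolding Cgen P_def by (rule K_subalgebra_generated[OF gens[unfolded P_def]])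
  show BC: "B \<subseteq> C"
    unfolding Bgen Cgen generated_algebra_def by (rule hull_mono) simp
  show "C \<subseteq> colon_inf P B g"
    unfolding Cgen
  proof (rule generated_algebra_least)
    show "K_subalgebra P (colon_inf P B g)"
      using K_subalgebra_colon_inf B gB P_def by blast
    have "set fs \<subseteq> colon_inf P B g"
      using generated_algebra_superset[of "set fs" P] subset_colon_inf[of V B g] B
      unfolding Bgen P_def by blast
    moreover have "poly_sat P (poly_subst fs H) g \<in> colon_inf P B g" if "H \<in> Hs" for H
    proof -
      have "H \<in> carrier ?R" using that Hs by blast
      with sat obtain k where "poly_subst fs H = g ^ k * poly_sat P (poly_subst fs H) g"
        by blast
      moreover have "poly_subst fs H \<in> B" using Bim \<open>H \<in> carrier ?R\<close> by blast
      ultimately have "g ^ k * poly_sat P (poly_subst fs H) g \<in> B" by metis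
      then show ?thesis
        using sat(1)[OF \<open>H \<in> carrier ?R\<close>] by (intro colon_infI)
    qed
    ultimately show "set fs \<union> (\<lambda>H. poly_sat P (poly_subst fs H) g) ` Hs \<subseteq> colon_inf P B g"
      by blast
  qed
  note clC = K_subalgebraD[OF C[unfolded P_def]]
  have gC: "g \<in> C" using gB BC by blast
  \<comment> \<open>The ideal property of \<open>?J\<close> replaces a representation of a relation as a combination of the
      elements of \<open>Hs\<close>.\<close>
  let ?J = "{H \<in> carrier ?R. \<exists>c\<in>C. poly_subst fs H = g * c}"
  have J: "ideal ?J ?R"
  proof (rule idealI[OF R.ring_axioms])
    show "subgroup ?J (add_monoid ?R)"
    proof (rule R.add.subgroupI)
      have "0 \<in> ?J"
        using clC(3) by (auto simp: zero_carrier_mpoly_ring intro!: bexI[of _ 0])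
      then show "?J \<noteq> {}" by blast
      fix H assume H: "H \<in> ?J"
      then obtain c where c: "c \<in> C" "poly_subst fs H = g * c" by blast
      have HR: "H \<in> carrier ?R" using H by blast
      have neg: "\<ominus>\<^bsub>?R\<^esub> H = const_poly (- 1) * H"
        using HR by (intro R.minus_equality)
          (auto simp: const_poly_simps mpoly_ring_closed)
      have "poly_subst fs (const_poly (- 1) * H) = g * (const_poly (- 1) * c)"
        using c by (simp add: poly_subst_mult const_poly_def poly_subst_single mult_ac)
      then show "\<ominus>\<^bsub>?R\<^esub> H \<in> ?J"
        unfolding neg using clC(6)[OF clC(2) c(1)] HR by (auto intro: mpoly_ring_closed)
      fix G assume "G \<in> ?J"
      then obtain d where d: "d \<in> C" "poly_subst fs G = g * d" "G \<in> carrier ?R" by blast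
      have "poly_subst fs (H + G) = g * (c + d)"
        using c d by (simp add: poly_subst_add distrib_left)
      then show "H \<oplus>\<^bsub>?R\<^esub> G \<in> ?J"
        using clC(5)[OF c(1) d(1)] HR d(3) by (auto intro: mpoly_ring_closed)
    qed auto
    fix H Q assume H: "H \<in> ?J" and Q: "Q \<in> carrier ?R"
    then obtain c where c: "c \<in> C" "poly_subst fs H = g * c" by blast
    have "poly_subst fs Q \<in> C" using Q Bim BC by blast
    moreover have "poly_subst fs (Q * H) = g * (poly_subst fs Q * c)"
      using c by (simp add: poly_subst_mult mult_ac)
    ultimately have "Q * H \<in> ?J"
      using clC(6)[OF _ c(1)] Q H by (auto intro: mpoly_ring_closed)
    then show "Q \<otimes>\<^bsub>?R\<^esub> H \<in> ?J" "H \<otimes>\<^bsub>?R\<^esub> Q \<in> ?J" by (simp_all add: mult.commute)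
  qed
  have HsJ: "Hs \<subseteq> ?J" if nonconst: "g \<notin> range const_poly"
  proof
    fix H assume H: "H \<in> Hs"
    then have HR: "H \<in> carrier ?R" using Hs by blast
    show "H \<in> ?J"
    proof (cases "poly_subst fs H = 0")
      case True
      then show ?thesis using HR clC(3) by (auto intro!: bexI[of _ 0])
    next
      case False
      have "H \<in> Rel P g fs"
        using H R.genideal_self[OF Hs] Idl by auto
      \<comment> \<open>Divisibility by the first power of \<open>g\<close> forces \<open>k \<ge> 1\<close> below.\<close>
      then obtain q where q: "q \<in> carrier P" "poly_subst fs H = g ^ 1 * q"
        using Rel_iff[OF gP[unfolded P_def] fs[unfolded P_def]] unfolding P_def by auto
      define h where "h = poly_sat P (poly_subst fs H) g"
      obtain k where k: "poly_subst fs H = g ^ k * h" "1 \<le> k"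
      proof (rule poly_sat_nonconst[OF substP[OF HR, unfolded P_def] False
            gP[unfolded P_def] nonconst, folded P_def, folded h_def])
        fix k assume eq: "poly_subst fs H = g ^ k * h"
          and max: "\<And>j q. q \<in> carrier P \<Longrightarrow> poly_subst fs H = g ^ j * q \<Longrightarrow> j \<le> k"
        show thesis by (rule that[OF eq max[OF q]])
      qed
      have "h \<in> C"
        unfolding Cgen h_def
        by (rule subsetD[OF generated_algebra_superset UnI2[OF imageI[OF H]]])
      then have "g ^ (k - 1) * h \<in> C"
        by (intro clC gC)
      moreover have "poly_subst fs H = g * (g ^ (k - 1) * h)"
        using k by (simp add: power_eq_if[of g k] mult.assoc)
      ultimately show ?thesis using HR by auto
    qed
  qed
  show "f \<in> C" if f: "f \<in> carrier P" and gf: "g * f \<in> B" for f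
  proof (cases "g \<in> range const_poly")
    case True
    then obtain c where c: "g = const_poly c" by blast
    then have "c \<noteq> 0" using g0 by (auto simp: const_poly_simps)
    then have "const_poly (inverse c) * g = 1"
      unfolding c by (metis const_poly_simps(2,4) left_inverse)
    then have "const_poly (inverse c) * (g * f) = f"
      by (simp flip: mult.assoc)
    moreover have "const_poly (inverse c) * (g * f) \<in> C"
      using clC(6)[OF clC(2)] gf BC by blast
    ultimately show ?thesis by (rule subst)
  next
    case False
    from gf Bim obtain F where F: "F \<in> carrier ?R" "g * f = poly_subst fs F" by blast
    then have "F \<in> Rel P g fs"
      using Rel_iff[OF gP[unfolded P_def] fs[unfolded P_def]] f unfolding P_def by metis
    then have "F \<in> ?J"
      using R.genideal_minimal[OF J HsJ[OF False]] Idl by blast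
    then obtain c where "c \<in> C" "g * f = g * c" using F by auto
    then show ?thesis using g0 by simp
  qed
qed

theorem theorem3p10:
  fixes n :: nat and P :: "'k::field mpoly ring" and gs :: "'k mpoly list"
    and g :: "'k mpoly" and S A :: "'k mpoly set"
  assumes "P = mpoly_ring {..n}"
    and "set gs \<subseteq> carrier P"
    and "S = generated_algebra P (set gs)"
    and "g \<in> S - {0}"
    and "K_subalgebra P A"
    and "finitely_generated_algebra P A"
    and "S \<subseteq> A"
    and "A \<subseteq> colon_inf P S g"
  shows
    "(\<forall>i E. E_iterates P g S i E \<longrightarrow>
        generated_algebra P (colon_pow P S g i) \<subseteq> E i \<and> E i \<subseteq> colon_inf P S g) \<and>
     (\<forall>i E. E_iterates P g S i E \<longrightarrow>
        S = E 0 \<and> (\<forall>j<i. E j \<subseteq> E (Suc j)) \<and> E i \<subseteq> colon_inf P S g) \<and>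
     colon_inf P A g = colon_inf P S g \<and>
     (is_E P g A A \<longrightarrow> A = colon_inf P S g)"
proof -
  note P = assms(1)
  have S: "K_subalgebra P S"
    unfolding assms(3) P by (rule K_subalgebra_generated[OF assms(2)[unfolded P]])
  have gP: "g \<in> carrier (mpoly_ring {..n})"
    using assms(4) K_subalgebra_subset[OF S[unfolded P]] by auto
  have iter: "K_subalgebra P (E i) \<and> colon_pow P S g i \<subseteq> E i \<and> E i \<subseteq> colon_inf P S g"
    if "E_iterates P g S i E" for i E
    using that
  proof (induction i)
    case 0
    then have "E 0 = S" by (simp add: E_iterates_def)
    then show ?case
      using S subset_colon_inf[OF S[unfolded P], folded P] by (auto simp: colon_pow_def)
  next
    case (Suc i)
    then have IH: "colon_pow P S g i \<subseteq> E i" "E i \<subseteq> colon_inf P S g"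
      and step: "is_E P g (E i) (E (Suc i))"
      by (auto simp: E_iterates_def)
    note E = is_E_subset[OF step[unfolded P], folded P]
    have "E (Suc i) \<subseteq> colon_inf P S g"
      by (rule order.trans[OF E(4) order.trans[OF colon_inf_mono[OF IH(2)] colon_inf_idem]])
    moreover have "colon_pow P S g (Suc i) \<subseteq> E (Suc i)"
    proof
      fix f assume "f \<in> colon_pow P S g (Suc i)"
      then have "f \<in> carrier P" "g * f \<in> E i"
        using IH(1) colon_pow_Suc[OF gP, folded P] by auto
      then show "f \<in> E (Suc i)" by (rule E(5))
    qed
    ultimately show ?case using E(2) by simp
  qed
  have mono: "E j \<subseteq> E (Suc j)" if "E_iterates P g S i E" "j < i" for i j E
    using that is_E_mono[of "{..n}" g "E j" "E (Suc j)"] by (simp add: P E_iterates_def)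
  have colon: "colon_inf P A g = colon_inf P S g"
    by (rule subset_antisym[OF order.trans[OF colon_inf_mono[OF assms(8)] colon_inf_idem]
          colon_inf_mono[OF assms(7)]])
  have fixpoint: "A = colon_inf P S g" if "is_E P g A A"
  proof -
    have "colon_pow P A g i \<subseteq> A" for i
    proof (induction i)
      case (Suc i)
      show ?case
      proof
        fix f assume "f \<in> colon_pow P A g (Suc i)"
        then have "f \<in> carrier P" "g * f \<in> A"
          using Suc colon_pow_Suc[OF gP, folded P] by auto
        then show "f \<in> A" by (rule is_E_colon[OF that[unfolded P], folded P])
      qed
    qed (auto simp: colon_pow_def)
    then have "colon_inf P A g \<subseteq> A" by (auto simp: colon_inf_def)
    then show ?thesis using colon assms(8) by simp
  qed
  have gen: "generated_algebra P (colon_pow P S g i) \<subseteq> E i" if "E_iterates P g S i E" for i E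
    using iter[OF that] by (intro generated_algebra_least) simp_all
  have start: "S = E 0" if "E_iterates P g S i E" for i E
    using that by (simp add: E_iterates_def)
  show ?thesis
    by (intro conjI allI impI)
      (fact gen iter[THEN conjunct2, THEN conjunct2] start mono colon fixpoint)+
qed

end
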